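(* Assume the nonexpansive case $\mu_2(\sigma A)\le 0$. Then for all $t\ge 0$ the error $L_m(t)v = \mathrm{e}^{\sigma t A}v - V_m\,\mathrm{e}^{\sigma t T_m}e_1$ of the Krylov approximation to $\mathrm{e}^{\sigma t A}v$ satisfies $$\| L_m(t)v \|_2 \;\leq\; \tau_{m+1,m}\,\gamma_m\,\frac{t^{m}}{m!}.$$
   Context: Setting: $A\in\mathbb{C}^{n\times n}$, $\sigma\in\mathbb{C}$ with $|\sigma|=1$, $v\in\mathbb{C}^n$ with $\|v\|_2=1$, $t\ge 0$ real, and $m\ge 1$ an integer. Krylov decomposition: the Arnoldi iteration (Lanczos if $A$ is Hermitian) applied to $A$ and $v$ is assumed to run until dimension $m$ without breakdown (i.e. $v,Av,\dots,A^m v$ are linearly independent). It yields a matrix $V_m\in\mathbb{C}^{n\times m}$ with $V_m^*V_m=I$ whose columns span $\mathcal{K}_m(A,v)=\mathrm{span}\{v,Av,\dots,A^{m-1}v\}$ and whose first column is $v$ (so $V_me_1=v$), an upper Hessenberg matrix $T_m=V_m^*AV_m\in\mathbb{C}^{m\times m}$ with positive lower diagonal entries $(T_m)_{j+1,j}>0$, a number $\tau_{m+1,m}>0$ and a vector $v_{m+1}\in\mathbb{C}^n$ with $\|v_{m+1}\|_2=1$, $V_m^*v_{m+1}=0$, such that $$A V_m = V_mT_m + \tau_{m+1,m}\,v_{m+1}e_m^*.$$ Here $e_1=(1,0,\dots,0)^*$ and $e_m=(0,\dots,0,1)^*$ in $\mathbb{C}^m$. Notation: $\gamma_m=e_m^*T_m^{m-1}e_1=\prod_{j=1}^{m-1}(T_m)_{j+1,j}$.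 Nonexpansive case: $\mu_2(\sigma A)\le 0$, where $\mu_2$ is the logarithmic norm associated with the 2-norm; equivalently the field of values $W(\sigma A)=\{x^*\sigma A x:\|x\|_2=1\}$ is contained in $\mathbb{C}_-=\{z:\mathrm{Re}\,z\le 0\}$. *)

theory Defs
  imports "Jordan_Normal_Form.Schur_Decomposition"
begin

definition vec_norm2 :: "complex vec \<Rightarrow> real" where
  "vec_norm2 x = sqrt (\<Sum>i<dim_vec x. (cmod (x $ i))\<^sup>2)"

definition mat_norm2 :: "complex mat \<Rightarrow> real" where
  "mat_norm2 M = Sup {vec_norm2 (M *\<^sub>v x) | x. x \<in> carrier_vec (dim_col M) \<and> vec_norm2 x = 1}"

text \<open>
  Logarithmic norm induced by the 2-norm. For square \<open>M\<close> of positive dimension the difference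
  quotient is monotone in \<open>h\<close> and bounded below by \<open>- mat_norm2 M\<close>, so the limit exists.
\<close>

definition log_norm2 :: "complex mat \<Rightarrow> real" where
  "log_norm2 M =
     Lim (at_right 0) (\<lambda>h. (mat_norm2 (1\<^sub>m (dim_row M) + complex_of_real h \<cdot>\<^sub>m M) - 1) / h)"

text \<open>The exponential series, taken entrywise (type \<open>mat\<close> carries no topology).\<close>

definition mat_exp :: "complex mat \<Rightarrow> complex mat" where
  "mat_exp M = mat (dim_row M) (dim_row M) (\<lambda>(i, j). \<Sum>k. (M ^\<^sub>m k) $$ (i, j) / fact k)"

text \<open>The list \<open>v, A v, \<dots>, A^(k-1) v\<close>.\<close>

definition krylov_vecs :: "complex mat \<Rightarrow> complex vec \<Rightarrow> nat \<Rightarrow> complex vec list" where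
  "krylov_vecs A v k = map (\<lambda>j. (A ^\<^sub>m j) *\<^sub>v v) [0..<k]"

definition krylov_space :: "nat \<Rightarrow> complex mat \<Rightarrow> complex vec \<Rightarrow> nat \<Rightarrow> complex vec set" where
  "krylov_space n A v k =
     LinearCombinations.module.span class_ring (module_vec TYPE(complex) n) (set (krylov_vecs A v k))"

text \<open>
  \<open>lin_indpt\<close> is a property of sets, so independence of the family also needs distinctness.
\<close>

definition no_breakdown :: "nat \<Rightarrow> complex mat \<Rightarrow> complex vec \<Rightarrow> nat \<Rightarrow> bool" where
  "no_breakdown n A v m \<longleftrightarrow>
     distinct (krylov_vecs A v (Suc m)) \<and>
     \<not> LinearCombinations.module.lin_dep class_ring (module_vec TYPE(complex) n)
         (set (krylov_vecs A v (Suc m)))"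

definition upper_hessenberg :: "complex mat \<Rightarrow> bool" where
  "upper_hessenberg M \<longleftrightarrow> (\<forall>i < dim_row M. \<forall>j < dim_col M. Suc j < i \<longrightarrow> M $$ (i, j) = 0)"

text \<open>The rank-one matrix \<open>x y*\<close>.\<close>

definition outer_prod :: "complex vec \<Rightarrow> complex vec \<Rightarrow> complex mat" where
  "outer_prod x y = mat (dim_vec x) (dim_vec y) (\<lambda>(i, j). x $ i * conjugate (y $ j))"

text \<open>
  The Arnoldi decomposition of dimension \<open>m\<close>. Indices start at \<open>0\<close>, so \<open>e\<^sub>1\<close> and \<open>e\<^sub>m\<close> are \<open>unit_vec m 0\<close> and \<open>unit_vec m (m - 1)\<close>. The order on \<open>complex\<close> is such that
  \<open>0 < z\<close> means that \<open>z\<close> is real and positive.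
\<close>

definition arnoldi_decomposition ::
  "nat \<Rightarrow> nat \<Rightarrow> complex mat \<Rightarrow> complex vec \<Rightarrow>
   complex mat \<Rightarrow> complex mat \<Rightarrow> real \<Rightarrow> complex vec \<Rightarrow> bool" where
  "arnoldi_decomposition n m A v V T \<tau> w \<longleftrightarrow>
     no_breakdown n A v m \<and>
     V \<in> carrier_mat n m \<and>
     mat_adjoint V * V = 1\<^sub>m m \<and>
     LinearCombinations.module.span class_ring (module_vec TYPE(complex) n) (set (cols V))
       = krylov_space n A v m \<and>
     col V 0 = v \<and>
     T = mat_adjoint V * A * V \<and>
     upper_hessenberg T \<and>
     (\<forall>j. Suc j < m \<longrightarrow> 0 < T $$ (Suc j, j)) \<and>
     0 < \<tau> \<and>
     w \<in> carrier_vec n \<and>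
     vec_norm2 w = 1 \<and>
     mat_adjoint V *\<^sub>v w = 0\<^sub>v m \<and>
     A * V = V * T + complex_of_real \<tau> \<cdot>\<^sub>m outer_prod w (unit_vec m (m - 1))"

text \<open>
  \<open>e\<^sub>m* T^(m-1) e\<^sub>1\<close>. For the matrices considered here it is real (see
  \<open>krylov_gamma_eq_prod\<close> below), so \<open>Re\<close> only changes the type.
\<close>

definition krylov_gamma :: "nat \<Rightarrow> complex mat \<Rightarrow> real" where
  "krylov_gamma m T = Re (((T ^\<^sub>m (m - 1)) *\<^sub>v unit_vec m 0) \<bullet>c unit_vec m (m - 1))"

lemma hessenberg_pow_col0:
  assumes T: "T \<in> carrier_mat m m" and H: "upper_hessenberg T" and km: "k < m"
  shows "(T ^\<^sub>m k) $$ (k, 0) = (\<Prod>j<k. T $$ (Suc j, j)) \<and>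
         (\<forall>i<m. k < i \<longrightarrow> (T ^\<^sub>m k) $$ (i, 0) = 0)"
  using km
proof (induction k)
  case 0
  then show ?case using T by auto
next
  case (Suc k)
  have P: "T ^\<^sub>m k \<in> carrier_mat m m" using T by simp
  have IH: "(T ^\<^sub>m k) $$ (k, 0) = (\<Prod>j<k. T $$ (Suc j, j))"
    "\<And>i. i < m \<Longrightarrow> k < i \<Longrightarrow> (T ^\<^sub>m k) $$ (i, 0) = 0"
    using Suc by auto
  have comm: "T ^\<^sub>m Suc k = T * T ^\<^sub>m k" for k
  proof (induction k)
    case 0
    then show ?case using T by simp
  next
    case (Suc k)
    have "T ^\<^sub>m Suc (Suc k) = (T * T ^\<^sub>m k) * T" using Suc by simp
    also have "\<dots> = T * (T ^\<^sub>m k * T)" using T by (intro assoc_mult_mat) auto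
    finally show ?case by simp
  qed
  have entry: "(T ^\<^sub>m Suc k) $$ (i, 0) = T $$ (i, k) * (T ^\<^sub>m k) $$ (k, 0)"
    if i: "i < m" "k < i" for i
  proof -
    have "(T ^\<^sub>m Suc k) $$ (i, 0) = (\<Sum>l\<in>{0..<m}. T $$ (i, l) * (T ^\<^sub>m k) $$ (l, 0))"
      unfolding comm using T P i by (simp add: scalar_prod_def)
    also have "\<dots> = (\<Sum>l\<in>{0..<m}. if l = k then T $$ (i, k) * (T ^\<^sub>m k) $$ (k, 0) else 0)"
    proof (rule sum.cong[OF refl])
      fix l assume "l \<in> {0..<m}"
      then have l: "l < m" by simp
      consider "l < k" | "l = k" | "k < l" by linarith
      then show "T $$ (i, l) * (T ^\<^sub>m k) $$ (l, 0)
          = (if l = k then T $$ (i, k) * (T ^\<^sub>m k) $$ (k, 0) else 0)"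
      proof cases
        case 1
        then have "T $$ (i, l) = 0"
          using H i l T unfolding upper_hessenberg_def by auto
        with 1 show ?thesis by simp
      qed (use IH(2) l in auto)
    qed
    also have "\<dots> = T $$ (i, k) * (T ^\<^sub>m k) $$ (k, 0)"
      using Suc.prems by simp
    finally show ?thesis .
  qed
  have "(T ^\<^sub>m Suc k) $$ (i, 0) = 0" if "i < m" "Suc k < i" for i
    using entry[of i] that H T unfolding upper_hessenberg_def by auto
  then show ?case using entry[of "Suc k"] Suc.prems IH(1) by (simp add: mult.commute)
qed

lemma krylov_gamma_eq_prod:
  assumes A: "A \<in> carrier_mat n n" and m: "1 \<le> m"
    and D: "arnoldi_decomposition n m A v V T \<tau> w"
  shows "((T ^\<^sub>m (m - 1)) *\<^sub>v unit_vec m 0) \<bullet>c unit_vec m (m - 1)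
      = complex_of_real (krylov_gamma m T)"
    and "krylov_gamma m T = (\<Prod>j<m - 1. Re (T $$ (Suc j, j)))"
proof -
  have V: "V \<in> carrier_mat n m" and TV: "T = mat_adjoint V * A * V"
    and H: "upper_hessenberg T" and pos: "\<And>j. Suc j < m \<Longrightarrow> 0 < T $$ (Suc j, j)"
    using D unfolding arnoldi_decomposition_def by auto
  have T: "T \<in> carrier_mat m m"
    unfolding TV using A V by (auto simp: mat_adjoint_def)
  have P: "T ^\<^sub>m (m - 1) \<in> carrier_mat m m" using T by simp
  have "((T ^\<^sub>m (m - 1)) *\<^sub>v unit_vec m 0) \<bullet>c unit_vec m (m - 1)
      = (T ^\<^sub>m (m - 1)) $$ (m - 1, 0)"
  proof -
    have "conjugate (unit_vec m (m - 1)) = (unit_vec m (m - 1) :: complex vec)"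
      by (rule eq_vecI) (auto simp: unit_vec_def)
    then show ?thesis using P T m by simp
  qed
  also have "\<dots> = (\<Prod>j<m - 1. T $$ (Suc j, j))"
    using hessenberg_pow_col0[OF T H, of "m - 1"] m by simp
  also have "\<dots> = (\<Prod>j<m - 1. complex_of_real (Re (T $$ (Suc j, j))))"
    using pos by (intro prod.cong) (auto simp: less_complex_def complex_eq_iff)
  finally have eq: "((T ^\<^sub>m (m - 1)) *\<^sub>v unit_vec m 0) \<bullet>c unit_vec m (m - 1)
      = complex_of_real (\<Prod>j<m - 1. Re (T $$ (Suc j, j)))" by simp
  then show 2: "krylov_gamma m T = (\<Prod>j<m - 1. Re (T $$ (Suc j, j)))"
    unfolding krylov_gamma_def eq by (simp only: Re_complex_of_real)
  show "((T ^\<^sub>m (m - 1)) *\<^sub>v unit_vec m 0) \<bullet>c unit_vec m (m - 1)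
      = complex_of_real (krylov_gamma m T)"
    using eq 2 by simp
qed

definition krylov_error ::
  "complex mat \<Rightarrow> complex vec \<Rightarrow> complex mat \<Rightarrow> complex mat \<Rightarrow> nat \<Rightarrow> complex \<Rightarrow> real \<Rightarrow> complex vec" where
  "krylov_error A v V T m \<sigma> t =
     mat_exp ((\<sigma> * complex_of_real t) \<cdot>\<^sub>m A) *\<^sub>v v
       - V *\<^sub>v (mat_exp ((\<sigma> * complex_of_real t) \<cdot>\<^sub>m T) *\<^sub>v unit_vec m 0)"

end

theory Submission
  imports Defs "HOL-Analysis.L2_Norm"
begin

text \<open>
  Write \<open>B = \<sigma> A\<close>, \<open>S = \<sigma> T\<close> and \<open>u = \<sigma> \<tau> w\<close>, so that \<open>B V = V S + u e\<^sub>m*\<close>. The error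
  \<open>X(t) = exp(t B) v - V exp(t S) e\<^sub>1\<close> solves \<open>X' = B X + (e\<^sub>m* exp(t S) e\<^sub>1) u\<close> with \<open>X(0) = 0\<close>. A
  nonpositive logarithmic norm means \<open>Re \<langle>B x, x\<rangle> \<le> 0\<close> for all \<open>x\<close>
  (\<open>dissipative_if_log_norm2_nonpos\<close>). Hence only the inhomogeneity can make the norm grow
  (\<open>dissipative_growth\<close>), and \<open>\<parallel>X(t)\<parallel>\<close> is at most \<open>\<parallel>u\<parallel> = \<tau>\<close> times the integral of
  \<open>|e\<^sub>m* exp(s S) e\<^sub>1|\<close> over \<open>[0, t]\<close> (\<open>krylov_relation_error_le\<close>).

  It remains to see that this last entry is at most \<open>\<gamma>\<^sub>m s^(m-1) / (m-1)!\<close>. One may write it as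
  \<open>\<gamma>\<^sub>m\<close> times a divided difference of the exponential function at the eigenvalues of \<open>S\<close>. The
  proof below avoids eigenvalues by using the error estimate itself
  (\<open>hessenberg_exp_last_entry_le\<close>). Since \<open>S\<close> is Hessenberg, its leading block of size \<open>m - 1\<close>
  gives a Krylov approximation of \<open>exp(s S) e\<^sub>1\<close> whose last entry is zero. The last entry of
  \<open>exp(s S) e\<^sub>1\<close> is therefore bounded by the error of this smaller approximation, where the role
  of \<open>\<tau>\<close> is played by the last subdiagonal entry of \<open>S\<close>. Compressions of dissipative matrices
  are dissipative (\<open>krylov_relation_dissipative\<close>), so induction on \<open>m\<close> collects the product of
  the subdiagonal entries, which is \<open>\<gamma>\<^sub>m\<close>.
\<close>

section \<open>The Euclidean norm and the Hermitian inner product\<close>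

lemma vec_norm2_eq_L2_set: "vec_norm2 x = L2_set (\<lambda>i. cmod (x $ i)) {..<dim_vec x}"
  by (simp add: vec_norm2_def L2_set_def)

lemma vec_norm2_nonneg [simp]: "0 \<le> vec_norm2 x"
  by (simp add: vec_norm2_def sum_nonneg)

lemma cscalar_prod_eq_sum:
  "dim_vec y = n \<Longrightarrow> x \<bullet>c y = (\<Sum>i<n. x $ i * cnj (y $ i))" for x y :: "complex vec"
  by (simp add: scalar_prod_def lessThan_atLeast0)

lemma cscalar_prod_commute:
  fixes x y :: "complex vec"
  assumes "x \<in> carrier_vec n" "y \<in> carrier_vec n"
  shows "x \<bullet>c y = cnj (y \<bullet>c x)"
  using assms by (auto simp: cscalar_prod_eq_sum[of _ n] mult.commute)

lemma vec_norm2_square: "(vec_norm2 x)\<^sup>2 = Re (x \<bullet>c x)"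
proof -
  have "complex_of_real ((vec_norm2 x)\<^sup>2) = x \<bullet>c x"
    by (simp add: cscalar_prod_eq_sum[OF refl] vec_norm2_def sum_nonneg complex_norm_square
        del: of_real_power)
  then show ?thesis by (metis Re_complex_of_real)
qed

lemma vec_norm2_smult: "vec_norm2 (a \<cdot>\<^sub>v x) = cmod a * vec_norm2 x"
  by (auto simp: vec_norm2_eq_L2_set norm_mult L2_set_right_distrib intro!: L2_set_cong)

lemma vec_norm2_add_le:
  assumes "x \<in> carrier_vec n" "y \<in> carrier_vec n"
  shows "vec_norm2 (x + y) \<le> vec_norm2 x + vec_norm2 y"
proof -
  have "vec_norm2 (x + y) \<le> L2_set (\<lambda>i. cmod (x $ i) + cmod (y $ i)) {..<n}"
    using assms by (auto simp: vec_norm2_eq_L2_set intro!: L2_set_mono norm_triangle_ineq)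
  also have "\<dots> \<le> vec_norm2 x + vec_norm2 y"
    using assms L2_set_triangle_ineq by (auto simp: vec_norm2_eq_L2_set)
  finally show ?thesis .
qed

lemma cmod_cscalar_prod_le:
  assumes "x \<in> carrier_vec n" "y \<in> carrier_vec n"
  shows "cmod (x \<bullet>c y) \<le> vec_norm2 x * vec_norm2 y"
proof -
  have "cmod (x \<bullet>c y) \<le> (\<Sum>i<n. \<bar>cmod (x $ i)\<bar> * \<bar>cmod (y $ i)\<bar>)"
    using assms by (auto simp: cscalar_prod_eq_sum[of y n] norm_mult intro!: sum_norm_le)
  also have "\<dots> \<le> vec_norm2 x * vec_norm2 y"
    using assms L2_set_mult_ineq[of "\<lambda>i. cmod (x $ i)" "\<lambda>i. cmod (y $ i)" "{..<n}"]
    by (auto simp: vec_norm2_eq_L2_set)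
  finally show ?thesis .
qed

lemma cmod_index_le_vec_norm2: "i < dim_vec x \<Longrightarrow> cmod (x $ i) \<le> vec_norm2 x"
  unfolding vec_norm2_eq_L2_set by (rule member_le_L2_set) auto

lemma vec_norm2_unit_vec: "i < n \<Longrightarrow> vec_norm2 (unit_vec n i) = 1"
proof -
  assume i: "i < n"
  have "(\<Sum>j<n. (cmod (unit_vec n i $ j))\<^sup>2) = (\<Sum>j<n. if j = i then 1 else 0)"
    using i by (intro sum.cong) (auto simp: unit_vec_def)
  then show ?thesis using i by (simp add: vec_norm2_def)
qed

lemma cscalar_prod_mat_adjoint:
  fixes V :: "complex mat"
  assumes "V \<in> carrier_mat n m" "x \<in> carrier_vec m" "y \<in> carrier_vec n"
  shows "(V *\<^sub>v x) \<bullet>c y = x \<bullet>c (mat_adjoint V *\<^sub>v y)"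
proof -
  have adj: "mat_adjoint V \<in> carrier_mat m n"
    and entry: "\<And>i j. i < n \<Longrightarrow> j < m \<Longrightarrow> mat_adjoint V $$ (j, i) = cnj (V $$ (i, j))"
    using assms by (auto simp: mat_adjoint_def mat_of_rows_def)
  have "(V *\<^sub>v x) \<bullet>c y = (\<Sum>i<n. \<Sum>j<m. V $$ (i, j) * x $ j * cnj (y $ i))"
    using assms by (auto simp: cscalar_prod_eq_sum[of y n] scalar_prod_def lessThan_atLeast0
        sum_distrib_right)
  also have "\<dots> = (\<Sum>j<m. \<Sum>i<n. V $$ (i, j) * x $ j * cnj (y $ i))"
    by (rule sum.swap)
  also have "\<dots> = x \<bullet>c (mat_adjoint V *\<^sub>v y)"
    using assms adj by (auto simp: cscalar_prod_eq_sum[of _ m] scalar_prod_def lessThan_atLeast0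
        sum_distrib_left entry mult_ac intro!: sum.cong)
  finally show ?thesis .
qed

section \<open>A nonpositive logarithmic norm means dissipativity\<close>

text \<open>
  This says that the field of values of the matrix lies in the closed left half plane.
\<close>

definition dissipative :: "nat \<Rightarrow> complex mat \<Rightarrow> bool" where
  "dissipative n B \<longleftrightarrow> (\<forall>x\<in>carrier_vec n. Re ((B *\<^sub>v x) \<bullet>c x) \<le> 0)"

text \<open>
  A crude bound for the operator norm. It is used only to know that the supremum defining the
  operator norm is over a bounded set and that the exponential series converges.
\<close>

definition entry_sum :: "complex mat \<Rightarrow> real" where
  "entry_sum M = (\<Sum>i<dim_row M. \<Sum>j<dim_col M. cmod (M $$ (i, j)))"

lemma entry_sum_nonneg: "0 \<le> entry_sum M"
  by (simp add: entry_sum_def sum_nonneg)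

lemma row_sum_le_entry_sum:
  "i < dim_row M \<Longrightarrow> (\<Sum>j<dim_col M. cmod (M $$ (i, j))) \<le> entry_sum M"
  unfolding entry_sum_def
  by (rule member_le_sum[of i "{..<dim_row M}" "\<lambda>i. \<Sum>j<dim_col M. cmod (M $$ (i, j))"])
    (auto simp: sum_nonneg)

lemma vec_norm2_mult_le_entry_sum:
  assumes "M \<in> carrier_mat n m" "x \<in> carrier_vec m" "vec_norm2 x = 1"
  shows "vec_norm2 (M *\<^sub>v x) \<le> entry_sum M"
proof -
  have "vec_norm2 (M *\<^sub>v x) \<le> (\<Sum>i<n. cmod ((M *\<^sub>v x) $ i))"
    using assms(1) L2_set_le_sum[of "{..<n}" "\<lambda>i. cmod ((M *\<^sub>v x) $ i)"]
    by (simp add: vec_norm2_eq_L2_set del: index_mult_mat_vec)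
  also have "\<dots> \<le> (\<Sum>i<n. \<Sum>j<m. cmod (M $$ (i, j)))"
  proof (rule sum_mono)
    fix i assume "i \<in> {..<n}"
    then have "cmod ((M *\<^sub>v x) $ i) \<le> (\<Sum>j<m. cmod (M $$ (i, j)) * cmod (x $ j))"
      using assms by (auto simp: scalar_prod_def lessThan_atLeast0 norm_mult intro!: sum_norm_le)
    also have "\<dots> \<le> (\<Sum>j<m. cmod (M $$ (i, j)))"
      using assms cmod_index_le_vec_norm2[of _ x] by (intro sum_mono mult_left_le) auto
    finally show "cmod ((M *\<^sub>v x) $ i) \<le> (\<Sum>j<m. cmod (M $$ (i, j)))" .
  qed
  finally show ?thesis using assms by (simp add: entry_sum_def)
qed

lemma vec_norm2_mult_le_mat_norm2:
  assumes "M \<in> carrier_mat n m" "x \<in> carrier_vec m" "vec_norm2 x = 1"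
  shows "vec_norm2 (M *\<^sub>v x) \<le> mat_norm2 M"
  unfolding mat_norm2_def
proof (rule cSup_upper)
  show "vec_norm2 (M *\<^sub>v x) \<in> {vec_norm2 (M *\<^sub>v x) |x. x \<in> carrier_vec (dim_col M) \<and> vec_norm2 x = 1}"
    using assms by auto
  show "bdd_above {vec_norm2 (M *\<^sub>v x) |x. x \<in> carrier_vec (dim_col M) \<and> vec_norm2 x = 1}"
    using assms by (auto intro!: bdd_aboveI[of _ "entry_sum M"] vec_norm2_mult_le_entry_sum)
qed

lemma mat_norm2_le:
  assumes "M \<in> carrier_mat n m" "0 < m"
    and "\<And>x. x \<in> carrier_vec m \<Longrightarrow> vec_norm2 x = 1 \<Longrightarrow> vec_norm2 (M *\<^sub>v x) \<le> K"
  shows "mat_norm2 M \<le> K"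
  unfolding mat_norm2_def
proof (rule cSup_least)
  show "{vec_norm2 (M *\<^sub>v x) |x. x \<in> carrier_vec (dim_col M) \<and> vec_norm2 x = 1} \<noteq> {}"
    using assms vec_norm2_unit_vec[of 0 m] by (auto intro!: exI[of _ "unit_vec m 0"])
qed (use assms in auto)

lemma one_plus_mult_vec:
  fixes M :: "complex mat"
  assumes "M \<in> carrier_mat n n" "x \<in> carrier_vec n"
  shows "(1\<^sub>m n + c \<cdot>\<^sub>m M) *\<^sub>v x = x + c \<cdot>\<^sub>v (M *\<^sub>v x)"
proof -
  have "(1\<^sub>m n + c \<cdot>\<^sub>m M) *\<^sub>v x = 1\<^sub>m n *\<^sub>v x + (c \<cdot>\<^sub>m M) *\<^sub>v x"
    using assms by (intro add_mult_distrib_mat_vec) auto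
  also have "(c \<cdot>\<^sub>m M) *\<^sub>v x = c \<cdot>\<^sub>v (M *\<^sub>v x)"
    using assms by (intro eq_vecI) auto
  finally show ?thesis using assms by simp
qed

definition log_norm_quotient :: "complex mat \<Rightarrow> real \<Rightarrow> real" where
  "log_norm_quotient M h =
     (mat_norm2 (1\<^sub>m (dim_row M) + complex_of_real h \<cdot>\<^sub>m M) - 1) / h"

text \<open>
  For a unit vector \<open>x\<close>, Cauchy-Schwarz gives
  \<open>1 + h Re \<langle>M x, x\<rangle> = Re \<langle>(I + h M) x, x\<rangle> \<le> \<parallel>I + h M\<parallel>\<close>.
\<close>

lemma Re_field_of_values_le_quotient:
  assumes M: "M \<in> carrier_mat n n" and x: "x \<in> carrier_vec n" "vec_norm2 x = 1" and h: "0 < h"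
  shows "Re ((M *\<^sub>v x) \<bullet>c x) \<le> log_norm_quotient M h"
proof -
  let ?E = "1\<^sub>m n + complex_of_real h \<cdot>\<^sub>m M"
  have E: "?E \<in> carrier_mat n n" using M by auto
  have Mx: "M *\<^sub>v x \<in> carrier_vec n" using M x by auto
  have cx: "conjugate x \<in> carrier_vec n" using x by auto
  have "(?E *\<^sub>v x) \<bullet>c x = x \<bullet>c x + complex_of_real h * ((M *\<^sub>v x) \<bullet>c x)"
    unfolding one_plus_mult_vec[OF M x(1)]
    using add_scalar_prod_distrib[OF x(1) _ cx, of "complex_of_real h \<cdot>\<^sub>v (M *\<^sub>v x)"]
      smult_scalar_prod_distrib[OF Mx cx, of "complex_of_real h"] Mx by auto
  then have "Re ((?E *\<^sub>v x) \<bullet>c x) = 1 + h * Re ((M *\<^sub>v x) \<bullet>c x)"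
    using x vec_norm2_square[of x] by simp
  moreover have "Re ((?E *\<^sub>v x) \<bullet>c x) \<le> vec_norm2 (?E *\<^sub>v x)"
    using order_trans[OF complex_Re_le_cmod cmod_cscalar_prod_le[OF mult_mat_vec_carrier[OF E x(1)] x(1)]]
    unfolding x(2) mult_1_right .
  moreover have "vec_norm2 (?E *\<^sub>v x) \<le> mat_norm2 ?E"
    using vec_norm2_mult_le_mat_norm2[OF E x] .
  ultimately show ?thesis
    using h M by (simp add: log_norm_quotient_def field_simps)
qed

text \<open>
  The norm is convex along \<open>h \<mapsto> I + h M\<close>: since
  \<open>I + h M = (1 - h / k) I + (h / k) (I + k M)\<close>, the slope of the norm, measured from \<open>h = 0\<close>
  where the norm is \<open>1\<close>, increases with \<open>h\<close>.
\<close>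

lemma log_norm_quotient_mono:
  assumes M: "M \<in> carrier_mat n n" and n: "0 < n" and h: "0 < h" "h \<le> k"
  shows "log_norm_quotient M h \<le> log_norm_quotient M k"
proof -
  let ?E = "\<lambda>h. 1\<^sub>m n + complex_of_real h \<cdot>\<^sub>m M"
  have E: "?E h \<in> carrier_mat n n" for h using M by auto
  have k: "0 < k" using h by simp
  have "mat_norm2 (?E h) \<le> (1 - h / k) + (h / k) * mat_norm2 (?E k)"
  proof (rule mat_norm2_le[OF E n])
    fix x :: "complex vec" assume x: "x \<in> carrier_vec n" "vec_norm2 x = 1"
    let ?r = "complex_of_real (1 - h / k)" and ?q = "complex_of_real (h / k)"
    have Ex: "?E k *\<^sub>v x \<in> carrier_vec n" using E x by (metis mult_mat_vec_carrier)
    have "?E h *\<^sub>v x = ?r \<cdot>\<^sub>v x + ?q \<cdot>\<^sub>v (?E k *\<^sub>v x)"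
      unfolding one_plus_mult_vec[OF M x(1)] using M x k
      by (intro eq_vecI) (auto simp: field_simps)
    then have "vec_norm2 (?E h *\<^sub>v x) \<le> vec_norm2 (?r \<cdot>\<^sub>v x) + vec_norm2 (?q \<cdot>\<^sub>v (?E k *\<^sub>v x))"
      using vec_norm2_add_le[of "?r \<cdot>\<^sub>v x" n "?q \<cdot>\<^sub>v (?E k *\<^sub>v x)"] x Ex by (metis smult_carrier_vec)
    also have "\<dots> = (1 - h / k) + (h / k) * vec_norm2 (?E k *\<^sub>v x)"
      unfolding vec_norm2_smult norm_of_real using x h k by simp
    also have "\<dots> \<le> (1 - h / k) + (h / k) * mat_norm2 (?E k)"
      using vec_norm2_mult_le_mat_norm2[OF E x] h k by (intro add_left_mono mult_left_mono) auto
    finally show "vec_norm2 (?E h *\<^sub>v x) \<le> (1 - h / k) + (h / k) * mat_norm2 (?E k)" .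
  qed
  then have "mat_norm2 (?E h) - 1 \<le> (h / k) * (mat_norm2 (?E k) - 1)"
    by (simp add: algebra_simps)
  then have "(mat_norm2 (?E h) - 1) / h \<le> (h / k) * (mat_norm2 (?E k) - 1) / h"
    using h by (intro divide_right_mono) auto
  then show ?thesis
    using h k M by (simp add: log_norm_quotient_def)
qed

text \<open>
  The limit that defines the logarithmic norm has to be shown to exist before anything can be
  concluded from its sign. The quotient is monotone and bounded below by any point of the real
  part of the field of values, so it converges to its infimum. That infimum dominates the real
  part of the whole field of values, and homogeneity extends the sign from unit vectors to all
  vectors.
\<close>

lemma dissipative_if_log_norm2_nonpos:
  assumes M: "M \<in> carrier_mat n n" and n: "0 < n" and nonpos: "log_norm2 M \<le> 0"
  shows "dissipative n M"
proof -
  let ?q = "log_norm_quotient M"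
  define L where "L = Inf (?q ` {0<..})"
  have bdd: "bdd_below (?q ` {0<..})"
    using Re_field_of_values_le_quotient[OF M unit_vec_carrier vec_norm2_unit_vec[OF n]]
    by (intro bdd_belowI2) auto
  have lower: "L \<le> ?q h" if "0 < h" for h
    unfolding L_def using bdd that by (auto intro!: cInf_lower)
  have lim: "(?q \<longlongrightarrow> L) (at_right 0)"
  proof (rule order_tendstoI)
    fix a assume "a < L"
    then show "\<forall>\<^sub>F h in at_right 0. a < ?q h"
      using lower by (auto simp: eventually_at_filter less_le_trans)
  next
    fix a assume "L < a"
    then obtain k where k: "0 < k" "?q k < a"
      unfolding L_def using cInf_lessD[of "?q ` {0<..}" a] by auto
    have "\<forall>\<^sub>F h in at_right 0. h \<in> {0<..<k}"
      using k by (intro eventually_at_right_real) auto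
    then show "\<forall>\<^sub>F h in at_right 0. ?q h < a"
    proof eventually_elim
      case (elim h)
      then show ?case using log_norm_quotient_mono[OF M n, of h k] k by auto
    qed
  qed
  have "log_norm2 M = Lim (at_right 0) ?q"
    by (simp add: log_norm2_def log_norm_quotient_def[abs_def])
  also have "\<dots> = L"
    using lim by (intro tendsto_Lim) auto
  finally have L: "L \<le> 0" using nonpos by simp
  have unit: "Re ((M *\<^sub>v x) \<bullet>c x) \<le> 0" if x: "x \<in> carrier_vec n" "vec_norm2 x = 1" for x
  proof -
    have "Re ((M *\<^sub>v x) \<bullet>c x) \<le> L"
      unfolding L_def using Re_field_of_values_le_quotient[OF M x] by (auto intro!: cInf_greatest)
    then show ?thesis using L by simp
  qed
  show ?thesis
    unfolding dissipative_def
  proof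
    fix x :: "complex vec" assume x: "x \<in> carrier_vec n"
    show "Re ((M *\<^sub>v x) \<bullet>c x) \<le> 0"
    proof (cases "vec_norm2 x = 0")
      case True
      then show ?thesis
        using cmod_cscalar_prod_le[of "M *\<^sub>v x" n x] M x complex_Re_le_cmod[of "(M *\<^sub>v x) \<bullet>c x"]
        by auto
    next
      case False
      define r where "r = vec_norm2 x"
      define y where "y = complex_of_real (1 / r) \<cdot>\<^sub>v x"
      have r: "0 < r" using False by (simp add: r_def order_less_le)
      have y: "y \<in> carrier_vec n" "vec_norm2 y = 1"
        using x r by (auto simp: y_def vec_norm2_smult norm_divide r_def)
      have "x = complex_of_real r \<cdot>\<^sub>v y"
        using x r by (intro eq_vecI) (auto simp: y_def)
      then have "(M *\<^sub>v x) \<bullet>c x = complex_of_real (r\<^sup>2) * ((M *\<^sub>v y) \<bullet>c y)"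
        using M y(1) by (simp add: mult_mat_vec conjugate_smult_vec power2_eq_square)
      then show ?thesis
        using unit[OF y] by (simp add: mult_nonneg_nonpos)
    qed
  qed
qed

section \<open>The matrix exponential as a solution of a linear differential equation\<close>

text \<open>
  The solution of \<open>X' = B X\<close> with \<open>X 0 = x\<close>.
\<close>

definition exp_orbit :: "complex mat \<Rightarrow> complex vec \<Rightarrow> real \<Rightarrow> complex vec" where
  "exp_orbit B x s = mat_exp (complex_of_real s \<cdot>\<^sub>m B) *\<^sub>v x"

lemma pow_mat_smult:
  fixes c :: complex
  assumes "B \<in> carrier_mat n n"
  shows "(c \<cdot>\<^sub>m B) ^\<^sub>m k = (c ^ k) \<cdot>\<^sub>m (B ^\<^sub>m k)"
proof (induction k)
  case 0
  then show ?case using assms by auto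
next
  case (Suc k)
  have P: "B ^\<^sub>m k \<in> carrier_mat n n" using assms by simp
  show ?case
    using Suc P assms mult_smult_distrib[OF P assms, of c]
      mult_smult_assoc_mat[OF P, of "c \<cdot>\<^sub>m B" n "c ^ k"]
    by (auto simp: mult.commute)
qed

text \<open>
  Powers are defined by multiplication on the right, whereas differentiating the exponential
  series has to produce a factor \<open>B\<close> on the left.
\<close>

lemma pow_mat_Suc_left:
  fixes B :: "complex mat"
  assumes "B \<in> carrier_mat n n"
  shows "B ^\<^sub>m Suc k = B * B ^\<^sub>m k"
proof (induction k)
  case 0
  then show ?case using assms by simp
next
  case (Suc k)
  have "B ^\<^sub>m Suc (Suc k) = (B * B ^\<^sub>m k) * B" using Suc by simp
  also have "\<dots> = B * (B ^\<^sub>m k * B)" using assms by (intro assoc_mult_mat) auto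
  finally show ?case by simp
qed

lemma pow_mat_Suc_entry:
  fixes B :: "complex mat"
  assumes "B \<in> carrier_mat n n" "i < n" "j < n"
  shows "(B ^\<^sub>m Suc k) $$ (i, j) = (\<Sum>l<n. B $$ (i, l) * (B ^\<^sub>m k) $$ (l, j))"
  using assms pow_carrier_mat[OF assms(1), of k] unfolding pow_mat_Suc_left[OF assms(1)]
  by (auto simp: scalar_prod_def lessThan_atLeast0)

lemma cmod_pow_mat_entry_le:
  assumes B: "B \<in> carrier_mat n n" and i: "i < n" and j: "j < n"
  shows "cmod ((B ^\<^sub>m k) $$ (i, j)) \<le> entry_sum B ^ k"
  using i
proof (induction k arbitrary: i)
  case 0
  then show ?case using B j by (auto simp: one_mat_def)
next
  case (Suc k)
  have "cmod ((B ^\<^sub>m Suc k) $$ (i, j)) \<le> (\<Sum>l<n. cmod (B $$ (i, l)) * entry_sum B ^ k)"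
    unfolding pow_mat_Suc_entry[OF B Suc.prems j] using Suc.IH
    by (auto simp: norm_mult intro!: sum_norm_le mult_left_mono)
  also have "\<dots> \<le> entry_sum B * entry_sum B ^ k"
    unfolding sum_distrib_right[symmetric]
    using row_sum_le_entry_sum[of i B] Suc.prems B entry_sum_nonneg[of B]
    by (intro mult_right_mono) auto
  finally show ?case by simp
qed

lemma summable_exp_entry:
  fixes z :: complex
  assumes "B \<in> carrier_mat n n" "i < n" "j < n"
  shows "summable (\<lambda>k. (B ^\<^sub>m k) $$ (i, j) / fact k * z ^ k)"
proof (rule summable_comparison_test)
  show "summable (\<lambda>k. inverse (fact k) * (entry_sum B * cmod z) ^ k)"
    by (rule summable_exp)
  show "\<exists>N. \<forall>k\<ge>N. cmod ((B ^\<^sub>m k) $$ (i, j) / fact k * z ^ k)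
      \<le> inverse (fact k) * (entry_sum B * cmod z) ^ k"
    using cmod_pow_mat_entry_le[OF assms]
    by (auto simp: norm_mult norm_divide norm_power power_mult_distrib divide_simps
        intro!: mult_right_mono)
qed

lemma mat_exp_entry:
  assumes "B \<in> carrier_mat n n" "i < n" "j < n"
  shows "mat_exp (z \<cdot>\<^sub>m B) $$ (i, j) = (\<Sum>k. (B ^\<^sub>m k) $$ (i, j) / fact k * z ^ k)"
  using assms pow_carrier_mat[OF assms(1)]
  by (auto simp: mat_exp_def pow_mat_smult[OF assms(1)] mult.commute)

lemma mat_exp_carrier: "B \<in> carrier_mat n n \<Longrightarrow> mat_exp (z \<cdot>\<^sub>m B) \<in> carrier_mat n n"
  by (auto simp: mat_exp_def)

lemma exp_orbit_carrier: "B \<in> carrier_mat n n \<Longrightarrow> exp_orbit B x s \<in> carrier_vec n"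
  unfolding exp_orbit_def by (rule carrier_vecI) (simp add: mat_exp_def)

lemma exp_orbit_0:
  assumes "B \<in> carrier_mat n n" "x \<in> carrier_vec n"
  shows "exp_orbit B x 0 = x"
proof -
  have "mat_exp (0 \<cdot>\<^sub>m B) = 1\<^sub>m n"
    using assms mat_exp_carrier[OF assms(1), of 0]
    by (intro eq_matI) (auto simp: mat_exp_entry powser_zero simp del: times_divide_eq_left)
  then show ?thesis using assms by (simp add: exp_orbit_def)
qed

text \<open>
  Each entry is an everywhere convergent power series with coefficients \<open>(B^k)\<^sub>i\<^sub>j / k!\<close>, so it can
  be differentiated term by term; the shifted coefficients are \<open>(B^(k+1))\<^sub>i\<^sub>j / k!\<close>, the entries
  of \<open>B\<close> times the original ones.
\<close>

lemma mat_exp_entry_has_vector_derivative: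
  assumes B: "B \<in> carrier_mat n n" and i: "i < n" and j: "j < n"
  shows "((\<lambda>s. mat_exp (complex_of_real s \<cdot>\<^sub>m B) $$ (i, j)) has_vector_derivative
      (\<Sum>l<n. B $$ (i, l) * mat_exp (complex_of_real s \<cdot>\<^sub>m B) $$ (l, j))) (at s)"
proof -
  let ?c = "\<lambda>i k. (B ^\<^sub>m k) $$ (i, j) / fact k"
  have diffs: "diffs (?c i) k = (\<Sum>l<n. B $$ (i, l) * ?c l k)" for k
  proof -
    have "diffs (?c i) k = (B ^\<^sub>m Suc k) $$ (i, j) / fact k"
      by (simp add: diffs_def del: pow_mat.simps of_nat_Suc)
    then show ?thesis
      unfolding pow_mat_Suc_entry[OF B i j] by (simp add: sum_divide_distrib)
  qed
  have "((\<lambda>z. \<Sum>k. ?c i k * z ^ k) has_field_derivative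
      (\<Sum>k. diffs (?c i) k * complex_of_real s ^ k)) (at (complex_of_real s))"
    by (rule termdiffs_strong_converges_everywhere) (rule summable_exp_entry[OF B i j])
  also have "(\<Sum>k. diffs (?c i) k * complex_of_real s ^ k)
      = (\<Sum>k. \<Sum>l<n. B $$ (i, l) * (?c l k * complex_of_real s ^ k))"
    by (simp add: diffs sum_distrib_right mult.assoc)
  also have "\<dots> = (\<Sum>l<n. B $$ (i, l) * (\<Sum>k. ?c l k * complex_of_real s ^ k))"
    using summable_exp_entry[OF B _ j]
    by (subst suminf_sum) (auto intro!: summable_mult suminf_mult sum.cong simp del: times_divide_eq_left)
  finally have "((\<lambda>s. \<Sum>k. ?c i k * complex_of_real s ^ k) has_vector_derivative
      (\<Sum>l<n. B $$ (i, l) * (\<Sum>k. ?c l k * complex_of_real s ^ k))) (at s)"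
    by (rule has_vector_derivative_real_field)
  then show ?thesis
    using B i j by (simp add: mat_exp_entry)
qed

lemma exp_orbit_has_vector_derivative:
  assumes B: "B \<in> carrier_mat n n" and x: "x \<in> carrier_vec n" and i: "i < n"
  shows "((\<lambda>s. exp_orbit B x s $ i) has_vector_derivative (B *\<^sub>v exp_orbit B x s) $ i) (at s)"
proof -
  let ?F = "\<lambda>s. mat_exp (complex_of_real s \<cdot>\<^sub>m B)"
  have entry: "exp_orbit B x s $ l = (\<Sum>j<n. ?F s $$ (l, j) * x $ j)" if "l < n" for l s
    using mat_exp_carrier[OF B, of "complex_of_real s"] x that
    by (auto simp: exp_orbit_def scalar_prod_def lessThan_atLeast0)
  have "((\<lambda>s. \<Sum>j<n. ?F s $$ (i, j) * x $ j) has_vector_derivative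
      (\<Sum>j<n. (\<Sum>l<n. B $$ (i, l) * ?F s $$ (l, j)) * x $ j)) (at s)"
    using mat_exp_entry_has_vector_derivative[OF B i]
    by (intro has_vector_derivative_sum has_vector_derivative_mult_left) auto
  also have "(\<Sum>j<n. (\<Sum>l<n. B $$ (i, l) * ?F s $$ (l, j)) * x $ j)
      = (\<Sum>l<n. \<Sum>j<n. B $$ (i, l) * (?F s $$ (l, j) * x $ j))"
    by (subst sum.swap) (simp add: sum_distrib_right mult.assoc)
  also have "\<dots> = (\<Sum>l<n. B $$ (i, l) * exp_orbit B x s $ l)"
    by (simp add: entry sum_distrib_left)
  also have "\<dots> = (B *\<^sub>v exp_orbit B x s) $ i"
    using B i exp_orbit_carrier[OF B, of x s]
    by (auto simp: scalar_prod_def lessThan_atLeast0)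
  finally show ?thesis using i by (simp add: entry)
qed

section \<open>Growth of solutions of dissipative equations\<close>

lemma has_real_derivative_cmod_square:
  assumes "(f has_vector_derivative f') (at s)"
  shows "((\<lambda>s. (cmod (f s))\<^sup>2) has_real_derivative 2 * Re (f' * cnj (f s))) (at s)"
  unfolding cmod_power2 using assms by (auto intro!: derivative_eq_intros simp: algebra_simps)

text \<open>
  A dissipative right-hand side cannot increase the norm, so the norm of a solution of
  \<open>X' = B X + g\<close> grows at most at the rate \<open>\<parallel>g\<parallel>\<close>. Formally,
  \<open>(\<parallel>X\<parallel>\<^sup>2)' = 2 Re \<langle>B X + g, X\<rangle> \<le> 2 \<parallel>g\<parallel> \<parallel>X\<parallel>\<close>, and dividing by \<open>2 \<parallel>X\<parallel>\<close> gives the claim.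
  This replaces the variation-of-constants integral together with the bound \<open>\<parallel>exp(s B)\<parallel> \<le> 1\<close>:
  the function \<open>G\<close> is an antiderivative of a bound for \<open>\<parallel>g\<parallel>\<close>.
\<close>

lemma dissipative_growth:
  assumes B: "B \<in> carrier_mat n n" "dissipative n B"
    and X: "\<And>s. X s \<in> carrier_vec n" and g: "\<And>s. g s \<in> carrier_vec n"
    and deriv: "\<And>s i. i < n \<Longrightarrow>
      ((\<lambda>s. X s $ i) has_vector_derivative (B *\<^sub>v X s + g s) $ i) (at s)"
    and G: "\<And>s. 0 \<le> s \<Longrightarrow> (G has_real_derivative G' s) (at s)"
    and bound: "\<And>s. 0 \<le> s \<Longrightarrow> vec_norm2 (g s) \<le> G' s"
    and t: "0 \<le> t"
  shows "vec_norm2 (X t) \<le> vec_norm2 (X 0) + G t - G 0"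
proof (rule field_le_epsilon)
  fix e :: real assume e: "0 < e"
  \<comment> \<open>The norm need not be differentiable where \<open>X\<close> vanishes. The function \<open>\<phi>\<close> is a smooth
    majorant of it that exceeds it by at most \<open>e\<close>.\<close>
  define N where "N s = (vec_norm2 (X s))\<^sup>2" for s
  define \<phi> where "\<phi> s = sqrt (N s + e\<^sup>2)" for s
  have N_nonneg: "0 \<le> N s" for s by (simp add: N_def)
  have pos: "0 < N s + e\<^sup>2" for s using N_nonneg[of s] e by (simp add: add_nonneg_pos)
  have norm_le: "vec_norm2 (X s) \<le> \<phi> s" for s
    unfolding \<phi>_def N_def by (rule real_le_rsqrt) simp
  define D where "D s = 2 * Re ((B *\<^sub>v X s + g s) \<bullet>c X s)" for s
  have N': "(N has_real_derivative D s) (at s)" for s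
  proof -
    have "((\<lambda>s. \<Sum>i<n. (cmod (X s $ i))\<^sup>2) has_real_derivative
        (\<Sum>i<n. 2 * Re ((B *\<^sub>v X s + g s) $ i * cnj (X s $ i)))) (at s)"
      using deriv by (intro DERIV_sum has_real_derivative_cmod_square) auto
    moreover have "N = (\<lambda>s. \<Sum>i<n. (cmod (X s $ i))\<^sup>2)"
      by (simp add: N_def vec_norm2_def sum_nonneg carrier_vecD[OF X] fun_eq_iff)
    moreover have "D s = (\<Sum>i<n. 2 * Re ((B *\<^sub>v X s + g s) $ i * cnj (X s $ i)))"
      using X[of s] unfolding D_def cscalar_prod_eq_sum[OF carrier_vecD[OF X[of s]]]
      by (simp only: Re_sum sum_distrib_left)
    ultimately show ?thesis by simp
  qed
  have D_le: "D s \<le> 2 * (vec_norm2 (g s) * vec_norm2 (X s))" for s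
  proof -
    have BX: "B *\<^sub>v X s \<in> carrier_vec n" using B X by simp
    have "D s = 2 * Re ((B *\<^sub>v X s) \<bullet>c X s) + 2 * Re (g s \<bullet>c X s)"
      unfolding D_def using add_scalar_prod_distrib[OF BX g[of s], of "conjugate (X s)"] X[of s] by simp
    moreover have "Re ((B *\<^sub>v X s) \<bullet>c X s) \<le> 0" using B X by (auto simp: dissipative_def)
    moreover have "Re (g s \<bullet>c X s) \<le> vec_norm2 (g s) * vec_norm2 (X s)"
      by (rule order_trans[OF complex_Re_le_cmod cmod_cscalar_prod_le[OF g X]])
    ultimately show ?thesis by simp
  qed
  have "\<phi> t - G t \<le> \<phi> 0 - G 0"
  proof (rule DERIV_nonpos_imp_nonincreasing[OF t])
    fix s assume s: "0 \<le> s" "s \<le> t"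
    have "(\<phi> has_real_derivative D s / (2 * \<phi> s)) (at s)"
      unfolding \<phi>_def[abs_def] using pos[of s] N'[of s]
      by (auto intro!: derivative_eq_intros simp: field_simps)
    then have "((\<lambda>s. \<phi> s - G s) has_real_derivative D s / (2 * \<phi> s) - G' s) (at s)"
      using G[OF s(1)] by (rule DERIV_diff)
    moreover have "D s / (2 * \<phi> s) - G' s \<le> 0"
    proof -
      have \<phi>: "0 < \<phi> s" using pos by (simp add: \<phi>_def)
      have "D s \<le> 2 * (G' s * \<phi> s)"
        using D_le[of s] mult_mono[OF bound[OF s(1)] norm_le[of s]] bound[OF s(1)] 
          order_trans[OF vec_norm2_nonneg bound[OF s(1)]] by simp
      then show ?thesis using \<phi> by (simp add: divide_simps mult_ac)
    qed
    ultimately show "\<exists>y. ((\<lambda>s. \<phi> s - G s) has_real_derivative y) (at s) \<and> y \<le> 0" by blast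
  qed
  moreover have "\<phi> 0 \<le> vec_norm2 (X 0) + e"
    using sqrt_sum_squares_le_sum[of "vec_norm2 (X 0)" e] e by (simp add: \<phi>_def N_def)
  ultimately show "vec_norm2 (X t) \<le> vec_norm2 (X 0) + G t - G 0 + e"
    using norm_le[of t] by simp
qed

section \<open>The error of a Krylov approximation\<close>

text \<open>
  What the error estimate uses of an Arnoldi decomposition: \<open>V\<close> is an isometry,
  \<open>B V = V S + u e\<^sub>m*\<close>, and \<open>u\<close> is orthogonal to the range of \<open>V\<close>. A
  leading block of a Hessenberg matrix is another instance, which is what the induction below
  relies on. The identities are stated through the action on vectors, which is the form needed
  for solutions of differential equations.
\<close>

definition krylov_relation ::
  "nat \<Rightarrow> nat \<Rightarrow> complex mat \<Rightarrow> complex mat \<Rightarrow> complex mat \<Rightarrow> complex vec \<Rightarrow> bool" where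
  "krylov_relation n m B V S u \<longleftrightarrow>
     0 < m \<and> B \<in> carrier_mat n n \<and> V \<in> carrier_mat n m \<and> S \<in> carrier_mat m m \<and> u \<in> carrier_vec n \<and>
     (\<forall>x\<in>carrier_vec m. \<forall>y\<in>carrier_vec m. (V *\<^sub>v x) \<bullet>c (V *\<^sub>v y) = x \<bullet>c y) \<and>
     (\<forall>x\<in>carrier_vec m. u \<bullet>c (V *\<^sub>v x) = 0) \<and>
     (\<forall>x\<in>carrier_vec m. B *\<^sub>v (V *\<^sub>v x) = V *\<^sub>v (S *\<^sub>v x) + x $ (m - 1) \<cdot>\<^sub>v u)"

text \<open>
  \<open>S\<close> is the compression of \<open>B\<close> to the range of \<open>V\<close>, because the residual \<open>u\<close> is orthogonal to
  that range. Hence its field of values is contained in that of \<open>B\<close>.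
\<close>

lemma krylov_relation_dissipative:
  assumes rel: "krylov_relation n m B V S u" and diss: "dissipative n B"
  shows "dissipative m S"
  unfolding dissipative_def
proof
  fix x :: "complex vec" assume x: "x \<in> carrier_vec m"
  have V: "V \<in> carrier_mat n m" and S: "S \<in> carrier_mat m m" and u: "u \<in> carrier_vec n"
    and iso: "\<And>y. y \<in> carrier_vec m \<Longrightarrow> (V *\<^sub>v y) \<bullet>c (V *\<^sub>v x) = y \<bullet>c x"
    and orth: "u \<bullet>c (V *\<^sub>v x) = 0"
    and BV: "B *\<^sub>v (V *\<^sub>v x) = V *\<^sub>v (S *\<^sub>v x) + x $ (m - 1) \<cdot>\<^sub>v u"
    using rel x by (auto simp: krylov_relation_def)
  have Sx: "S *\<^sub>v x \<in> carrier_vec m" and Vx: "V *\<^sub>v x \<in> carrier_vec n"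
    and cVx: "conjugate (V *\<^sub>v x) \<in> carrier_vec n"
    using S V x by auto
  have VSx: "V *\<^sub>v (S *\<^sub>v x) \<in> carrier_vec n" using V Sx by auto
  have "(B *\<^sub>v (V *\<^sub>v x)) \<bullet>c (V *\<^sub>v x)
      = (V *\<^sub>v (S *\<^sub>v x)) \<bullet>c (V *\<^sub>v x) + x $ (m - 1) * (u \<bullet>c (V *\<^sub>v x))"
    unfolding BV
    using u add_scalar_prod_distrib[OF VSx _ cVx, of "x $ (m - 1) \<cdot>\<^sub>v u"]
      smult_scalar_prod_distrib[OF u cVx, of "x $ (m - 1)"] by simp
  also have "\<dots> = (S *\<^sub>v x) \<bullet>c x"
    using iso[OF Sx] orth by simp
  finally show "Re ((S *\<^sub>v x) \<bullet>c x) \<le> 0"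
    using diss Vx by (auto simp: dissipative_def)
qed

lemma mult_mat_vec_has_vector_derivative:
  fixes V :: "complex mat"
  assumes V: "V \<in> carrier_mat n m" and X: "\<And>s. X s \<in> carrier_vec m" "X' \<in> carrier_vec m"
    and deriv: "\<And>j. j < m \<Longrightarrow> ((\<lambda>s. X s $ j) has_vector_derivative X' $ j) (at s)"
    and i: "i < n"
  shows "((\<lambda>s. (V *\<^sub>v X s) $ i) has_vector_derivative (V *\<^sub>v X') $ i) (at s)"
proof -
  have entry: "(V *\<^sub>v y) $ i = (\<Sum>j<m. V $$ (i, j) * y $ j)" if "y \<in> carrier_vec m" for y
    using V i that by (auto simp: scalar_prod_def lessThan_atLeast0)
  show ?thesis
    unfolding entry[OF X(1)] entry[OF X(2)]
    using deriv by (intro has_vector_derivative_sum has_vector_derivative_mult_right) auto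
qed

lemma has_real_derivative_power_over_fact:
  "((\<lambda>s. C * (s ^ Suc k / fact (Suc k))) has_real_derivative C * (s ^ k / fact k)) (at s)"
proof -
  have "((\<lambda>s. C * (s ^ Suc k / fact (Suc k))) has_real_derivative
      C * (real (Suc k) * s ^ k / fact (Suc k))) (at s)"
    using DERIV_pow[of "Suc k" s] by (intro DERIV_cmult DERIV_cdivide) simp
  then show ?thesis by (simp del: of_nat_Suc power_Suc)
qed

text \<open>
  The error \<open>X = exp(t B) V z - V exp(t S) z\<close> vanishes at \<open>t = 0\<close> and satisfies \<open>X' = B X + g\<close>,
  where \<open>g\<close> is the last entry of \<open>exp(t S) z\<close> times \<open>u\<close>. A bound for that single entry therefore
  integrates to a bound for the error.
\<close>

lemma krylov_relation_error_le:
  assumes rel: "krylov_relation n m B V S u" and diss: "dissipative n B" and z: "z \<in> carrier_vec m"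
    and last: "\<And>s. 0 \<le> s \<Longrightarrow> cmod (exp_orbit S z s $ (m - 1)) \<le> C * (s ^ (m - 1) / fact (m - 1))"
    and t: "0 \<le> t"
  shows "vec_norm2 (exp_orbit B (V *\<^sub>v z) t - V *\<^sub>v exp_orbit S z t)
      \<le> vec_norm2 u * C * (t ^ m / fact m)"
proof -
  have m: "0 < m" and B: "B \<in> carrier_mat n n" and V: "V \<in> carrier_mat n m"
    and S: "S \<in> carrier_mat m m" and u: "u \<in> carrier_vec n"
    and BV: "\<And>x. x \<in> carrier_vec m \<Longrightarrow> B *\<^sub>v (V *\<^sub>v x) = V *\<^sub>v (S *\<^sub>v x) + x $ (m - 1) \<cdot>\<^sub>v u"
    using rel by (auto simp: krylov_relation_def)
  obtain k where k: "m = Suc k" using m gr0_implies_Suc by blast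
  let ?y = "\<lambda>s. exp_orbit B (V *\<^sub>v z) s" and ?z = "\<lambda>s. exp_orbit S z s"
  define X where "X s = ?y s - V *\<^sub>v ?z s" for s
  define g where "g s = ?z s $ (m - 1) \<cdot>\<^sub>v u" for s
  have Vz: "V *\<^sub>v z \<in> carrier_vec n" using V z by simp
  have y: "?y s \<in> carrier_vec n" and z': "?z s \<in> carrier_vec m" for s
    using exp_orbit_carrier B S by auto
  have Vz': "V *\<^sub>v ?z s \<in> carrier_vec n" and Sz': "S *\<^sub>v ?z s \<in> carrier_vec m" for s
    using V S z' by auto
  have VSz': "V *\<^sub>v (S *\<^sub>v ?z s) \<in> carrier_vec n" for s using V Sz' by auto
  have X: "X s \<in> carrier_vec n" for s using y Vz' by (auto simp: X_def)
  have g: "g s \<in> carrier_vec n" for s using u by (simp add: g_def)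
  have X_deriv: "((\<lambda>s. X s $ i) has_vector_derivative (B *\<^sub>v X s + g s) $ i) (at s)"
    if i: "i < n" for i s
  proof -
    have "((\<lambda>s. ?y s $ i - (V *\<^sub>v ?z s) $ i) has_vector_derivative
        (B *\<^sub>v ?y s) $ i - (V *\<^sub>v (S *\<^sub>v ?z s)) $ i) (at s)"
      using exp_orbit_has_vector_derivative[OF B Vz i]
        mult_mat_vec_has_vector_derivative[OF V z' Sz' exp_orbit_has_vector_derivative[OF S z] i]
      by (rule has_vector_derivative_diff)
    moreover have "B *\<^sub>v X s = B *\<^sub>v ?y s - B *\<^sub>v (V *\<^sub>v ?z s)"
      unfolding X_def by (rule mult_minus_distrib_mat_vec[OF B y Vz'])
    then have "(B *\<^sub>v X s + g s) $ i = (B *\<^sub>v ?y s) $ i - (V *\<^sub>v (S *\<^sub>v ?z s)) $ i"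
      using BV[OF z'] i B V u by (simp add: g_def del: index_mult_mat_vec)
    ultimately show ?thesis
      using i B V by (simp add: X_def del: index_mult_mat_vec)
  qed
  have X0: "X 0 = 0\<^sub>v n"
    unfolding X_def exp_orbit_0[OF B Vz] exp_orbit_0[OF S z] by (rule minus_cancel_vec[OF Vz])
  define c where "c = vec_norm2 u * C"
  have "vec_norm2 (X t) \<le> vec_norm2 (X 0)
      + c * (t ^ Suc k / fact (Suc k)) - c * (0 ^ Suc k / fact (Suc k))"
  proof (rule dissipative_growth[OF B diss X g X_deriv has_real_derivative_power_over_fact _ t])
    fix s :: real assume s: "0 \<le> s"
    show "vec_norm2 (g s) \<le> c * (s ^ k / fact k)"
      using mult_right_mono[OF last[OF s] vec_norm2_nonneg[of u]] k
      by (simp add: g_def vec_norm2_smult c_def mult_ac)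
  qed
  moreover have "vec_norm2 (X 0) = 0" by (simp add: X0 vec_norm2_def)
  ultimately show ?thesis by (simp add: X_def c_def k)
qed

section \<open>The last entry of the exponential of a Hessenberg matrix\<close>

text \<open>
  The isometry of \<open>m\<close>-dimensional into \<open>(m + 1)\<close>-dimensional space that appends a zero entry.
\<close>

definition padding_mat :: "nat \<Rightarrow> complex mat" where
  "padding_mat m = mat (Suc m) m (\<lambda>(i, j). if i = j then 1 else 0)"

lemma padding_mat_carrier: "padding_mat m \<in> carrier_mat (Suc m) m"
  by (simp add: padding_mat_def)

lemma padding_mat_mult_index:
  assumes "x \<in> carrier_vec m" "i < Suc m"
  shows "(padding_mat m *\<^sub>v x) $ i = (if i < m then x $ i else 0)"
proof -
  have "(padding_mat m *\<^sub>v x) $ i = (\<Sum>j<m. (if i = j then 1 else 0) * x $ j)"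
    using assms by (simp add: padding_mat_def scalar_prod_def lessThan_atLeast0)
  also have "\<dots> = (\<Sum>j<m. if j = i then x $ i else 0)"
    by (intro sum.cong) auto
  finally show ?thesis by simp
qed

text \<open>
  The last row of a Hessenberg matrix has at most one nonzero entry left of the diagonal. So applied
  to a vector with vanishing last entry the matrix acts as its leading block, up to a multiple of the
  last unit vector.
\<close>

lemma leading_block_krylov_relation:
  assumes S: "S \<in> carrier_mat (Suc m) (Suc m)" and H: "upper_hessenberg S" and m: "0 < m"
  defines "V \<equiv> padding_mat m"
    and "S' \<equiv> mat m m (\<lambda>(i, j). S $$ (i, j))"
    and "u \<equiv> S $$ (m, m - 1) \<cdot>\<^sub>v unit_vec (Suc m) m"
  shows "krylov_relation (Suc m) m S V S' u"
proof -
  have V: "V \<in> carrier_mat (Suc m) m" unfolding V_def by (rule padding_mat_carrier)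
  note embed = padding_mat_mult_index[of _ m, folded V_def]
  have iso: "(V *\<^sub>v x) \<bullet>c (V *\<^sub>v y) = x \<bullet>c y" if "x \<in> carrier_vec m" "y \<in> carrier_vec m" for x y
    using that V by (simp add: cscalar_prod_eq_sum[of _ "Suc m"] cscalar_prod_eq_sum[of y m]
        embed del: index_mult_mat_vec)
  have orth: "u \<bullet>c (V *\<^sub>v x) = 0" if "x \<in> carrier_vec m" for x
    using that V by (simp add: cscalar_prod_eq_sum[of _ "Suc m"] embed u_def unit_vec_def
        del: index_mult_mat_vec)
  have "S *\<^sub>v (V *\<^sub>v x) = V *\<^sub>v (S' *\<^sub>v x) + x $ (m - 1) \<cdot>\<^sub>v u" if x: "x \<in> carrier_vec m" for x
  proof (rule eq_vecI)
    show "dim_vec (S *\<^sub>v (V *\<^sub>v x)) = dim_vec (V *\<^sub>v (S' *\<^sub>v x) + x $ (m - 1) \<cdot>\<^sub>v u)"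
      using S by (simp add: u_def)
    have S'x: "S' *\<^sub>v x \<in> carrier_vec m" 
      unfolding S'_def by (rule mult_mat_vec_carrier[OF mat_carrier x])
    fix i assume "i < dim_vec (V *\<^sub>v (S' *\<^sub>v x) + x $ (m - 1) \<cdot>\<^sub>v u)"
    then have i: "i < Suc m" by (simp add: u_def)
    have "(S *\<^sub>v (V *\<^sub>v x)) $ i = (\<Sum>j<Suc m. S $$ (i, j) * (V *\<^sub>v x) $ j)"
      using S V i by (simp add: scalar_prod_def lessThan_atLeast0 del: sum.op_ivl_Suc)
    then have Sx: "(S *\<^sub>v (V *\<^sub>v x)) $ i = (\<Sum>j<m. S $$ (i, j) * x $ j)"
      by (simp add: embed[OF x] del: index_mult_mat_vec)
    show "(S *\<^sub>v (V *\<^sub>v x)) $ i = (V *\<^sub>v (S' *\<^sub>v x) + x $ (m - 1) \<cdot>\<^sub>v u) $ i"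
    proof (cases "i < m")
      case True
      then have "(S' *\<^sub>v x) $ i = (\<Sum>j<m. S $$ (i, j) * x $ j)"
        using x by (auto simp: S'_def scalar_prod_def lessThan_atLeast0)
      then show ?thesis
        using True i Sx embed[OF S'x i] by (simp add: u_def unit_vec_def del: index_mult_mat_vec)
    next
      case False
      then have im: "i = m" using i by simp
      have "(\<Sum>j<m. S $$ (i, j) * x $ j)
          = (\<Sum>j<m. if j = m - 1 then S $$ (m, m - 1) * x $ (m - 1) else 0)"
        using H S im by (intro sum.cong) (auto simp: upper_hessenberg_def)
      then show ?thesis
        using im i m Sx embed[OF S'x i] by (simp add: u_def unit_vec_def del: index_mult_mat_vec)
    qed
  qed
  then show ?thesis
    using S m V iso orth by (auto simp: krylov_relation_def S'_def u_def)
qed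

text \<open>
  The leading block \<open>S'\<close> of \<open>S\<close> stands in a Krylov relation to \<open>S\<close>, with the padding isometry as
  \<open>V\<close>. The approximation \<open>V exp(s S') e\<^sub>1\<close> of \<open>exp(s S) e\<^sub>1\<close> has last entry zero, so the last entry of
  \<open>exp(s S) e\<^sub>1\<close> is an entry of the approximation error. By induction on the size, the error
  estimate for \<open>S'\<close> bounds it, and each step contributes one subdiagonal entry and one
  integration.
\<close>

lemma hessenberg_exp_last_entry_le:
  assumes "S \<in> carrier_mat (Suc k) (Suc k)" "upper_hessenberg S" "dissipative (Suc k) S" "0 \<le> s"
  shows "cmod (exp_orbit S (unit_vec (Suc k) 0) s $ k)
      \<le> (\<Prod>j<k. cmod (S $$ (Suc j, j))) * (s ^ k / fact k)"
  using assms
proof (induction k arbitrary: S s)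
  case 0
  \<comment> \<open>A one-by-one dissipative matrix generates contractions: the growth estimate with \<open>g = 0\<close>.\<close>
  let ?X = "exp_orbit S (unit_vec (Suc 0) 0)"
  have e: "unit_vec (Suc 0) 0 \<in> carrier_vec (Suc 0)" by simp
  have X: "?X s \<in> carrier_vec (Suc 0)" for s by (rule exp_orbit_carrier[OF 0(1)])
  have SX: "S *\<^sub>v ?X s \<in> carrier_vec (Suc 0)" for s using 0(1) X by auto
  have "vec_norm2 (?X s) \<le> vec_norm2 (?X 0) + 0 - 0"
  proof (rule dissipative_growth[OF 0(1,3) X zero_carrier_vec _ _ _ 0(4)])
    fix i :: nat and s :: real assume i: "i < Suc 0"
    show "((\<lambda>s. ?X s $ i) has_vector_derivative (S *\<^sub>v ?X s + 0\<^sub>v (Suc 0)) $ i) (at s)"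
      unfolding right_zero_vec[OF SX] by (rule exp_orbit_has_vector_derivative[OF 0(1) e i])
  next
    show "((\<lambda>s. 0) has_real_derivative 0) (at s)" for s :: real by simp
    show "vec_norm2 (0\<^sub>v (Suc 0)) \<le> 0" by (simp add: vec_norm2_def)
  qed
  then have "vec_norm2 (?X s) \<le> 1"
    using exp_orbit_0[OF 0(1) e] vec_norm2_unit_vec[of 0 "Suc 0"] by simp
  then show ?case
    using cmod_index_le_vec_norm2[of 0 "?X s"] X[of s] by simp
next
  case (Suc k)
  let ?m = "Suc k"
  define V where "V = padding_mat ?m"
  define S' where "S' = mat ?m ?m (\<lambda>(i, j). S $$ (i, j))"
  define u where "u = S $$ (?m, ?m - 1) \<cdot>\<^sub>v unit_vec (Suc ?m) ?m"
  let ?e = "unit_vec ?m 0 :: complex vec"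
  have rel: "krylov_relation (Suc ?m) ?m S V S' u"
    unfolding V_def S'_def u_def by (rule leading_block_krylov_relation[OF Suc.prems(1,2)]) simp
  have S': "S' \<in> carrier_mat ?m ?m" by (simp add: S'_def)
  have H': "upper_hessenberg S'"
    using Suc.prems(1,2) by (auto simp: upper_hessenberg_def S'_def)
  define C where "C = (\<Prod>j<k. cmod (S $$ (Suc j, j)))"
  have C: "C = (\<Prod>j<k. cmod (S' $$ (Suc j, j)))" by (auto simp: C_def S'_def)
  have "cmod (exp_orbit S' ?e r $ (?m - 1)) \<le> C * (r ^ (?m - 1) / fact (?m - 1))" if "0 \<le> r" for r
    using Suc.IH[OF S' H' krylov_relation_dissipative[OF rel Suc.prems(3)] that] by (simp add: C)
  from krylov_relation_error_le[OF rel Suc.prems(3) unit_vec_carrier this Suc.prems(4)]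
  have err: "vec_norm2 (exp_orbit S (V *\<^sub>v ?e) s - V *\<^sub>v exp_orbit S' ?e s)
      \<le> vec_norm2 u * C * (s ^ ?m / fact ?m)" .
  note embed = padding_mat_mult_index[of _ ?m, folded V_def]
  have Ve: "V *\<^sub>v ?e = unit_vec (Suc ?m) 0"
  proof (rule eq_vecI)
    fix i assume "i < dim_vec (unit_vec (Suc ?m) 0 :: complex vec)"
    then show "(V *\<^sub>v ?e) $ i = unit_vec (Suc ?m) 0 $ i"
      using embed[of ?e i] by (simp add: unit_vec_def del: index_mult_mat_vec)
  qed (simp add: V_def padding_mat_def)
  have last: "(V *\<^sub>v exp_orbit S' ?e s) $ ?m = 0"
    using embed[OF exp_orbit_carrier[OF S'], of ?m] by simp
  let ?d = "exp_orbit S (unit_vec (Suc ?m) 0) s - V *\<^sub>v exp_orbit S' ?e s"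
  have dim: "dim_vec ?d = Suc ?m" by (simp add: V_def padding_mat_def)
  have entry: "?d $ ?m = exp_orbit S (unit_vec (Suc ?m) 0) s $ ?m"
    using last dim by (simp del: index_mult_mat_vec)
  have "cmod (exp_orbit S (unit_vec (Suc ?m) 0) s $ ?m) \<le> vec_norm2 ?d"
    using cmod_index_le_vec_norm2[of ?m ?d, unfolded dim entry] by blast
  also have "\<dots> \<le> vec_norm2 u * C * (s ^ ?m / fact ?m)"
    using err unfolding Ve .
  also have "vec_norm2 u = cmod (S $$ (Suc k, k))"
    by (simp add: u_def vec_norm2_smult vec_norm2_unit_vec)
  finally show ?case by (simp add: C_def mult_ac)
qed

section \<open>The Arnoldi approximation\<close>

text \<open>
  The factor \<open>\<sigma>\<close> is absorbed into both matrices and into the residual vector.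
\<close>

lemma arnoldi_decomposition_krylov_relation:
  assumes A: "A \<in> carrier_mat n n" and m: "1 \<le> m"
    and D: "arnoldi_decomposition n m A v V T \<tau> w"
  shows "krylov_relation n m (\<sigma> \<cdot>\<^sub>m A) V (\<sigma> \<cdot>\<^sub>m T) ((\<sigma> * complex_of_real \<tau>) \<cdot>\<^sub>v w)"
proof -
  have V: "V \<in> carrier_mat n m" and VV: "mat_adjoint V * V = 1\<^sub>m m"
    and TV: "T = mat_adjoint V * A * V"
    and w: "w \<in> carrier_vec n" and Vw: "mat_adjoint V *\<^sub>v w = 0\<^sub>v m"
    and AV: "A * V = V * T + complex_of_real \<tau> \<cdot>\<^sub>m outer_prod w (unit_vec m (m - 1))"
    using D unfolding arnoldi_decomposition_def by auto
  have adj: "mat_adjoint V \<in> carrier_mat m n" using V by (auto simp: mat_adjoint_def)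
  have T: "T \<in> carrier_mat m m" unfolding TV using A V adj by auto
  have iso: "(V *\<^sub>v x) \<bullet>c (V *\<^sub>v y) = x \<bullet>c y" if "x \<in> carrier_vec m" "y \<in> carrier_vec m" for x y
  proof -
    have "mat_adjoint V *\<^sub>v (V *\<^sub>v y) = y"
      using assoc_mult_mat_vec[OF adj V that(2)] VV that by simp
    then show ?thesis
      using cscalar_prod_mat_adjoint[OF V that(1), of "V *\<^sub>v y"] V that by simp
  qed
  have orth: "((\<sigma> * complex_of_real \<tau>) \<cdot>\<^sub>v w) \<bullet>c (V *\<^sub>v x) = 0" if x: "x \<in> carrier_vec m" for x
  proof -
    have Vx: "V *\<^sub>v x \<in> carrier_vec n" using V x by auto
    have "(V *\<^sub>v x) \<bullet>c w = 0"
      using cscalar_prod_mat_adjoint[OF V x w] x by (simp add: Vw)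
    then have "w \<bullet>c (V *\<^sub>v x) = 0"
      unfolding cscalar_prod_commute[OF w Vx] by simp
    then show ?thesis using w Vx by simp
  qed
  have "(\<sigma> \<cdot>\<^sub>m A) *\<^sub>v (V *\<^sub>v x)
      = V *\<^sub>v ((\<sigma> \<cdot>\<^sub>m T) *\<^sub>v x) + x $ (m - 1) \<cdot>\<^sub>v ((\<sigma> * complex_of_real \<tau>) \<cdot>\<^sub>v w)"
    if x: "x \<in> carrier_vec m" for x
  proof -
    let ?P = "complex_of_real \<tau> \<cdot>\<^sub>m outer_prod w (unit_vec m (m - 1))"
    have P: "?P \<in> carrier_mat n m" using w by (auto simp: outer_prod_def)
    have Px: "?P *\<^sub>v x = (complex_of_real \<tau> * x $ (m - 1)) \<cdot>\<^sub>v w"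
    proof (rule eq_vecI)
      fix i assume "i < dim_vec ((complex_of_real \<tau> * x $ (m - 1)) \<cdot>\<^sub>v w)"
      then have i: "i < n" using w by simp
      have "(?P *\<^sub>v x) $ i = (\<Sum>j<m. complex_of_real \<tau> * (w $ i * cnj (unit_vec m (m - 1) $ j)) * x $ j)"
        using w x i by (simp add: outer_prod_def scalar_prod_def lessThan_atLeast0)
      also have "\<dots> = (\<Sum>j<m. if j = m - 1 then complex_of_real \<tau> * w $ i * x $ (m - 1) else 0)"
        using m by (intro sum.cong) (auto simp: unit_vec_def)
      finally show "(?P *\<^sub>v x) $ i = ((complex_of_real \<tau> * x $ (m - 1)) \<cdot>\<^sub>v w) $ i"
        using m w i by (simp del: index_mult_mat_vec)
    qed (use w in \<open>simp add: outer_prod_def\<close>)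
    have "A *\<^sub>v (V *\<^sub>v x) = (A * V) *\<^sub>v x"
      using A V x by simp
    also have "\<dots> = (V * T) *\<^sub>v x + ?P *\<^sub>v x"
      unfolding AV using V T P x by (intro add_mult_distrib_mat_vec) auto
    also have "(V * T) *\<^sub>v x = V *\<^sub>v (T *\<^sub>v x)"
      using V T x by simp
    finally have eq: "A *\<^sub>v (V *\<^sub>v x) = V *\<^sub>v (T *\<^sub>v x) + (complex_of_real \<tau> * x $ (m - 1)) \<cdot>\<^sub>v w"
      unfolding Px .
    have smult: "(\<sigma> \<cdot>\<^sub>m M) *\<^sub>v y = \<sigma> \<cdot>\<^sub>v (M *\<^sub>v y)"
      if "M \<in> carrier_mat k l" "y \<in> carrier_vec l" for M k l y
      using that by (intro eq_vecI) auto
    have "V *\<^sub>v ((\<sigma> \<cdot>\<^sub>m T) *\<^sub>v x) = \<sigma> \<cdot>\<^sub>v (V *\<^sub>v (T *\<^sub>v x))"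
      using smult[OF T x] mult_mat_vec[OF V, of "T *\<^sub>v x" \<sigma>] T x by simp
    moreover have "(\<sigma> \<cdot>\<^sub>m A) *\<^sub>v (V *\<^sub>v x) = \<sigma> \<cdot>\<^sub>v (A *\<^sub>v (V *\<^sub>v x))"
      using smult[OF A] V x by simp
    ultimately show ?thesis
      unfolding eq using V w
      by (intro eq_vecI) (auto simp: algebra_simps simp del: index_mult_mat_vec)
  qed
  then show ?thesis
    using A V T w m iso orth by (auto simp: krylov_relation_def)
qed

theorem theorem1:
  fixes n m :: nat and A V T :: "complex mat" and v w :: "complex vec"
    and \<sigma> :: complex and \<tau> t :: real
  assumes "A \<in> carrier_mat n n"
    and "cmod \<sigma> = 1"
    and "v \<in> carrier_vec n"
    and "vec_norm2 v = 1"
    and "1 \<le> m"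
    and "arnoldi_decomposition n m A v V T \<tau> w"
    and "log_norm2 (\<sigma> \<cdot>\<^sub>m A) \<le> 0"
    and "0 \<le> t"
  shows "vec_norm2 (krylov_error A v V T m \<sigma> t) \<le> \<tau> * krylov_gamma m T * (t ^ m / fact m)"
proof -
  let ?B = "\<sigma> \<cdot>\<^sub>m A" and ?S = "\<sigma> \<cdot>\<^sub>m T" and ?u = "(\<sigma> * complex_of_real \<tau>) \<cdot>\<^sub>v w"
  let ?e = "unit_vec m 0 :: complex vec"
  have V: "V \<in> carrier_mat n m" and v: "col V 0 = v" and H: "upper_hessenberg T"
    and pos: "\<And>j. Suc j < m \<Longrightarrow> 0 < T $$ (Suc j, j)" and \<tau>: "0 < \<tau>" and w: "vec_norm2 w = 1"
    using assms(6) unfolding arnoldi_decomposition_def by auto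
  have rel: "krylov_relation n m ?B V ?S ?u"
    by (rule arnoldi_decomposition_krylov_relation[OF assms(1,5,6)])
  have S: "?S \<in> carrier_mat m m" and B: "?B \<in> carrier_mat n n" using rel by (auto simp: krylov_relation_def)
  have T: "T \<in> carrier_mat m m" using S unfolding carrier_mat_def by simp
  \<comment> \<open>In dimension zero there is no unit vector.\<close>
  have n: "0 < n"
    using assms(3,4) by (cases n) (auto simp: vec_norm2_def)
  have diss: "dissipative n ?B"
    by (rule dissipative_if_log_norm2_nonpos[OF B n assms(7)])
  obtain k where k: "m = Suc k" using assms(5) by (cases m) auto
  have HS: "upper_hessenberg ?S" using H T by (auto simp: upper_hessenberg_def)
  \<comment> \<open>The subdiagonal of \<open>T\<close> is positive and \<open>\<sigma>\<close> has modulus one, so passing to moduli loses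
    nothing.\<close>
  have "(\<Prod>j<k. cmod (?S $$ (Suc j, j))) = krylov_gamma m T"
  proof -
    have "cmod (?S $$ (Suc j, j)) = Re (T $$ (Suc j, j))" if "j < k" for j
      using pos[of j] that k T assms(2)
      by (auto simp: norm_mult less_complex_def cmod_eq_Re)
    then show ?thesis
      using krylov_gamma_eq_prod(2)[OF assms(1,5,6)] k by simp
  qed
  then have last: "cmod (exp_orbit ?S ?e s $ (m - 1)) \<le> krylov_gamma m T * (s ^ (m - 1) / fact (m - 1))"
    if "0 \<le> s" for s
    using hessenberg_exp_last_entry_le[of ?S k s] krylov_relation_dissipative[OF rel diss] S HS that k by simp
  have Ve: "V *\<^sub>v ?e = v"
    using V assms(5) v[symmetric] by (intro eq_vecI) auto
  have orbit: "exp_orbit (\<sigma> \<cdot>\<^sub>m M) x t = mat_exp ((\<sigma> * complex_of_real t) \<cdot>\<^sub>m M) *\<^sub>v x" for M x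
    unfolding exp_orbit_def
    by (rule arg_cong[where f = "\<lambda>N. mat_exp N *\<^sub>v x"]) (intro eq_matI, auto)
  have "krylov_error A v V T m \<sigma> t = exp_orbit ?B (V *\<^sub>v ?e) t - V *\<^sub>v exp_orbit ?S ?e t"
    by (simp add: krylov_error_def orbit Ve)
  also have "vec_norm2 \<dots> \<le> vec_norm2 ?u * krylov_gamma m T * (t ^ m / fact m)"
    by (rule krylov_relation_error_le[OF rel diss unit_vec_carrier last assms(8)])
  also have "vec_norm2 ?u = \<tau>"
    using \<tau> w assms(2) by (simp add: vec_norm2_smult norm_mult)
  finally show ?thesis .
qed

end
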